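(* For every graph $H$ (connected, with at least three nodes, of constant size) that is not a clique and every $r \geq 1$, the $r$-round bandwidth complexity of $\textsc{MemList}(H)$ under edge insertions is $\Omega(n/r)$.
   Context: Dynamic network model: a sequence of graphs $G^0, G^1, \ldots$ on $n$ nodes, each obtained from the previous by at most one edge insertion; nodes have distinct IDs from $[n]$, know their neighbors' IDs and initially the whole of $G^0$; communication is synchronous, each round the change happens first, then each node sends a $B$-bit message to each neighbor; nodes detect changes only via their neighbor lists; algorithms are deterministic. An $r$-round algorithm works under the promise that each change at round $i$ is followed by $r-1$ change-free rounds and must output correctly for $G^i$ by the end of round $i+r-1$. The $r$-round bandwidth complexity is the minimum such $B$. $\textsc{MemList}(H)$: each node $v$ lists all subgraphs of the current graph isomorphic to $H$ that contain $v$. *)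

theory Defs
  imports Complex_Main "HOL-Library.Extended_Real"
begin

section \<open>Finite simple graphs\<close>

type_synonym 'a ugraph = "'a set \<times> 'a set set"

abbreviation verts :: "'a ugraph \<Rightarrow> 'a set" where
  "verts \<equiv> fst"

abbreviation edges :: "'a ugraph \<Rightarrow> 'a set set" where
  "edges \<equiv> snd"

definition simple_graph :: "'a ugraph \<Rightarrow> bool" where
  "simple_graph G \<longleftrightarrow> finite (verts G) \<and>
     edges G \<subseteq> {{u, v} | u v. u \<in> verts G \<and> v \<in> verts G \<and> u \<noteq> v}"

definition neighbors :: "'a ugraph \<Rightarrow> 'a \<Rightarrow> 'a set" where
  "neighbors G v = {u. {u, v} \<in> edges G}"

definition connected_graph :: "'a ugraph \<Rightarrow> bool" where
  "connected_graph G \<longleftrightarrow>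
     (\<forall>u\<in>verts G. \<forall>v\<in>verts G. (u, v) \<in> {(x, y). {x, y} \<in> edges G}\<^sup>*)"

definition is_clique :: "'a ugraph \<Rightarrow> bool" where
  "is_clique G \<longleftrightarrow> (\<forall>u\<in>verts G. \<forall>v\<in>verts G. u \<noteq> v \<longrightarrow> {u, v} \<in> edges G)"

text \<open>Subgraphs are not required to be induced.\<close>

definition subgraph :: "'a ugraph \<Rightarrow> 'a ugraph \<Rightarrow> bool" where
  "subgraph S G \<longleftrightarrow> simple_graph S \<and> verts S \<subseteq> verts G \<and> edges S \<subseteq> edges G"

definition graph_iso :: "'a ugraph \<Rightarrow> 'b ugraph \<Rightarrow> bool" where
  "graph_iso G H \<longleftrightarrow> (\<exists>f. bij_betw f (verts G) (verts H) \<and>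
     (\<forall>u\<in>verts G. \<forall>v\<in>verts G. {u, v} \<in> edges G \<longleftrightarrow> {f u, f v} \<in> edges H))"


section \<open>Dynamic networks under edge insertions\<close>

text \<open>The nodes are identified with their distinct IDs \<open>1, \<dots>, n\<close>; \<open>G 0\<close> is the initial
  graph, and the change of round \<open>i \<ge> 1\<close> leads from \<open>G (i - 1)\<close> to \<open>G i\<close>.\<close>

definition insertion_sequence :: "nat \<Rightarrow> (nat \<Rightarrow> nat ugraph) \<Rightarrow> bool" where
  "insertion_sequence n G \<longleftrightarrow>
     (\<forall>i. simple_graph (G i) \<and> verts (G i) = {1..n}) \<and>
     (\<forall>i. edges (G (Suc i)) = edges (G i) \<or> (\<exists>e. edges (G (Suc i)) = insert e (edges (G i))))"

definition change_at :: "(nat \<Rightarrow> nat ugraph) \<Rightarrow> nat \<Rightarrow> bool" where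
  "change_at G i \<longleftrightarrow> 1 \<le> i \<and> G i \<noteq> G (i - 1)"

definition promise :: "nat \<Rightarrow> (nat \<Rightarrow> nat ugraph) \<Rightarrow> bool" where
  "promise r G \<longleftrightarrow> (\<forall>i. change_at G i \<longrightarrow> (\<forall>j. i < j \<and> j \<le> i + r - 1 \<longrightarrow> \<not> change_at G j))"

type_synonym message = "bool list"

text \<open>What a node observes in one round: its neighbor list after the change, and the messages
  received from these neighbors (\<open>None\<close> for every other node). A history lists the rounds in
  chronological order.\<close>

type_synonym history = "(nat set \<times> (nat \<Rightarrow> message option)) list"

text \<open>Local memory and computation are unrestricted, so a deterministic algorithm is given by
  functions of everything a node knows: its ID, the initial graph and its history. The message
  function additionally takes the neighbor list of the current round, then the recipient. The
  number \<open>n\<close> of nodes is determined by the initial graph.\<close>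

record 'o algorithm =
  send :: "nat \<Rightarrow> nat ugraph \<Rightarrow> history \<Rightarrow> nat set \<Rightarrow> nat \<Rightarrow> message"
  answer :: "nat \<Rightarrow> nat ugraph \<Rightarrow> history \<Rightarrow> 'o"

definition has_bandwidth :: "'o algorithm \<Rightarrow> nat \<Rightarrow> bool" where
  "has_bandwidth A B \<longleftrightarrow> (\<forall>v G0 h N w. length (send A v G0 h N w) = B)"

text \<open>\<open>history_after A G i v\<close> is the history of node \<open>v\<close> at the end of round \<open>i\<close>.\<close>

fun history_after :: "'o algorithm \<Rightarrow> (nat \<Rightarrow> nat ugraph) \<Rightarrow> nat \<Rightarrow> nat \<Rightarrow> history" where
  "history_after A G 0 v = []"
| "history_after A G (Suc i) v = history_after A G i v @
     [(neighbors (G (Suc i)) v,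
       \<lambda>u. if u \<in> neighbors (G (Suc i)) v
           then Some (send A u (G 0) (history_after A G i u) (neighbors (G (Suc i)) u) v)
           else None)]"

text \<open>A problem \<open>P\<close> assigns to a graph and a node the output required of that node. Nothing is
  required of outputs in rounds other than \<open>i + r - 1\<close> for a change round \<open>i\<close>; further
  requirements could only increase the bandwidth complexity.\<close>

definition solves :: "'o algorithm \<Rightarrow> nat \<Rightarrow> nat \<Rightarrow> (nat ugraph \<Rightarrow> nat \<Rightarrow> 'o) \<Rightarrow> bool" where
  "solves A n r P \<longleftrightarrow> (\<forall>G. insertion_sequence n G \<and> promise r G \<longrightarrow>
     (\<forall>i. change_at G i \<longrightarrow>
       (\<forall>v\<in>{1..n}. answer A v (G 0) (history_after A G (i + r - 1) v) = P (G i) v)))"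

text \<open>The value is \<open>\<infinity>\<close> if no bandwidth suffices, which happens when \<open>r\<close> rounds are too few for
  the necessary information to reach all nodes.\<close>

definition bandwidth_complexity ::
    "nat \<Rightarrow> nat \<Rightarrow> (nat ugraph \<Rightarrow> nat \<Rightarrow> 'o) \<Rightarrow> enat" where
  "bandwidth_complexity n r P =
     (INF B \<in> {B. \<exists>A. has_bandwidth A B \<and> solves A n r P}. enat B)"

definition mem_list :: "'h ugraph \<Rightarrow> nat ugraph \<Rightarrow> nat \<Rightarrow> nat ugraph set" where
  "mem_list H G v = {S. subgraph S G \<and> graph_iso S H \<and> v \<in> verts S}"

end

theory Submission
  imports Defs "HOL-Library.FuncSet"
begin

text \<open>Choose non-adjacent vertices \<open>u\<close>, \<open>v\<close> of \<open>H\<close> and a neighbor \<open>w\<close> of \<open>v\<close>. The network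
  consists of a copy of \<open>H - v\<close> in which \<open>u\<close> is still isolated, and of \<open>m\<close> candidates for \<open>v\<close>,
  each joined to the copies of all neighbors of \<open>v\<close> except \<open>w\<close>. The adversary first joins \<open>w\<close> to
  an arbitrary subset \<open>S\<close> of the candidates and only then joins \<open>u\<close> to its \<open>d\<close> neighbors. In the
  end \<open>u\<close> has to know \<open>S\<close>, since the \<open>j\<close>-th candidate completes a copy of \<open>H\<close> iff \<open>j \<in> S\<close>; but
  all it can learn about \<open>S\<close> are the messages of at most \<open>d\<close> neighbors during the last \<open>d r\<close>
  rounds. Hence \<open>2 ^ m \<le> 2 ^ (B d\<^sup>2 r)\<close>.\<close>

section \<open>Counting histories\<close>

text \<open>The messages arriving in one round amount to a function from \<open>N\<close> to bit
  strings of length \<open>B\<close>. Recoding options as extensional functions bounds their number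
  by \<open>(2 ^ B) ^ card N\<close>.\<close>

lemma finite_card_bounded_messages:
  assumes "finite N"
  shows "finite {g. \<forall>u. if u \<in> N then \<exists>l::message. length l = B \<and> g u = Some l else g u = None}"
    (is "finite ?M")
    and "card {g. \<forall>u. if u \<in> N then \<exists>l::message. length l = B \<and> g u = Some l else g u = None}
      \<le> 2 ^ (B * card N)"
proof -
  let ?L = "{l::message. set l \<subseteq> UNIV \<and> length l = B}"
  let ?F = "N \<rightarrow>\<^sub>E ?L"
  have L: "finite ?L" "card ?L = 2 ^ B"
    using finite_lists_length_eq[of "UNIV :: bool set" B] card_lists_length_eq[of "UNIV :: bool set" B]
    by simp_all
  have fin: "finite ?F"
    using assms L by (intro finite_PiE) auto
  have sub: "?M \<subseteq> (\<lambda>h u. if u \<in> N then Some (h u) else None) ` ?F"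
  proof
    fix g assume g: "g \<in> ?M"
    have "g = (\<lambda>u. if u \<in> N then Some (restrict (the \<circ> g) N u) else None)"
    proof
      fix u show "g u = (if u \<in> N then Some (restrict (the \<circ> g) N u) else None)"
        using g by (cases "u \<in> N") (auto dest!: spec[of _ u])
    qed
    moreover have "restrict (the \<circ> g) N \<in> ?F"
    proof (rule restrict_PiE_iff[THEN iffD2], rule ballI)
      fix u assume "u \<in> N"
      with g obtain l where "length l = B" "g u = Some l"
        by (auto dest!: spec[of _ u])
      then show "(the \<circ> g) u \<in> ?L" by simp
    qed
    ultimately show "g \<in> (\<lambda>h u. if u \<in> N then Some (h u) else None) ` ?F"
      by (rule image_eqI)
  qed
  show "finite ?M" using sub fin finite_surj by blast
  have "card ?M \<le> card ?F" using sub fin by (rule surj_card_le[rotated])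
  also have "\<dots> = 2 ^ (B * card N)"
    using assms L by (simp add: card_PiE power_mult)
  finally show "card ?M \<le> 2 ^ (B * card N)" .
qed

text \<open>The neighbor lists \<open>N j\<close> are common to the whole family, so only received
  bits can vary, and round \<open>j\<close> multiplies the number of histories by at most
  \<open>2 ^ (B * card (N j))\<close>. How the senders compute their messages is irrelevant.\<close>

lemma card_histories_le:
  assumes bw: "has_bandwidth A B"
    and nb: "\<And>S j. S \<in> \<S> \<Longrightarrow> 1 \<le> j \<Longrightarrow> j \<le> i \<Longrightarrow> neighbors (G S j) v = N j"
    and fin: "\<And>j. finite (N j)"
  shows "finite ((\<lambda>S. history_after A (G S) i v) ` \<S>) \<and>
    card ((\<lambda>S. history_after A (G S) i v) ` \<S>) \<le> 2 ^ (B * (\<Sum>j=1..i. card (N j)))"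
  using nb
proof (induction i)
  case 0
  show ?case by (cases "\<S> = {}") (simp_all add: image_constant_conv)
next
  case (Suc i)
  let ?h = "\<lambda>i S. history_after A (G S) i v"
  let ?M = "{g. \<forall>u. if u \<in> N (Suc i) then \<exists>l::message. length l = B \<and> g u = Some l else g u = None}"
  have IH: "finite (?h i ` \<S>)" "card (?h i ` \<S>) \<le> 2 ^ (B * (\<Sum>j=1..i. card (N j)))"
    using Suc.IH Suc.prems by auto
  note M = finite_card_bounded_messages[OF fin[of "Suc i"], of B]
  have sub: "?h (Suc i) ` \<S> \<subseteq> (\<lambda>(h, g). h @ [(N (Suc i), g)]) ` (?h i ` \<S> \<times> ?M)"
  proof
    fix h assume "h \<in> ?h (Suc i) ` \<S>"
    then obtain S where S: "S \<in> \<S>" and h: "h = ?h (Suc i) S" by blast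
    have nS: "neighbors (G S (Suc i)) v = N (Suc i)" using Suc.prems S by simp
    let ?g = "\<lambda>u. if u \<in> N (Suc i)
        then Some (send A u (G S 0) (history_after A (G S) i u) (neighbors (G S (Suc i)) u) v)
        else None"
    have "h = (\<lambda>(h, g). h @ [(N (Suc i), g)]) (?h i S, ?g)"
      using h nS by simp
    moreover have "?g \<in> ?M" using bw unfolding has_bandwidth_def by (simp del: split_paired_All)
    ultimately show "h \<in> (\<lambda>(h, g). h @ [(N (Suc i), g)]) ` (?h i ` \<S> \<times> ?M)"
      using S by blast
  qed
  have finp: "finite (?h i ` \<S> \<times> ?M)" using IH(1) M(1) by simp
  have "card (?h (Suc i) ` \<S>) \<le> card (?h i ` \<S> \<times> ?M)"
    using sub finp by (rule surj_card_le[rotated])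
  also have "\<dots> \<le> 2 ^ (B * (\<Sum>j=1..i. card (N j))) * 2 ^ (B * card (N (Suc i)))"
    unfolding card_cartesian_product using IH(2) M(2) by (rule mult_le_mono)
  also have "\<dots> = 2 ^ (B * (\<Sum>j=1..Suc i. card (N j)))"
    by (simp add: power_add algebra_simps)
  finally show ?case using sub finp finite_surj by blast
qed

text \<open>An answer is a function of the ID, the common initial graph and the history. Pairwise
  distinct required outputs therefore force pairwise distinct histories, which have just been
  counted.\<close>

lemma indistinguishable_family_bound:
  assumes bw: "has_bandwidth A B"
    and solves: "solves A n r P"
    and seq: "\<And>S. S \<in> \<S> \<Longrightarrow> insertion_sequence n (G S) \<and> promise r (G S)"
    and change: "\<And>S. S \<in> \<S> \<Longrightarrow> change_at (G S) i"
    and init: "\<And>S. S \<in> \<S> \<Longrightarrow> G S 0 = G0"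
    and v: "v \<in> {1..n}"
    and nb: "\<And>S j. S \<in> \<S> \<Longrightarrow> 1 \<le> j \<Longrightarrow> j \<le> i + r - 1 \<Longrightarrow> neighbors (G S j) v = N j"
    and fin: "\<And>j. finite (N j)"
    and inj: "inj_on (\<lambda>S. P (G S i) v) \<S>"
  shows "card \<S> \<le> 2 ^ (B * (\<Sum>j=1..i + r - 1. card (N j)))"
proof -
  let ?h = "\<lambda>S. history_after A (G S) (i + r - 1) v"
  have ans: "answer A v G0 (?h S) = P (G S i) v" if "S \<in> \<S>" for S
    using solves seq[OF that] change[OF that] init[OF that] v unfolding solves_def by metis
  have "inj_on ?h \<S>"
  proof (rule inj_onI)
    fix S T assume "S \<in> \<S>" "T \<in> \<S>" "?h S = ?h T"
    then show "S = T" using ans inj by (metis (mono_tags, lifting) inj_onD)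
  qed
  then have "card \<S> = card (?h ` \<S>)" by (simp add: card_image)
  also have "\<dots> \<le> 2 ^ (B * (\<Sum>j=1..i + r - 1. card (N j)))"
    using card_histories_le[where \<S> = \<S> and G = G and N = N, OF bw nb fin] by blast
  finally show ?thesis .
qed

section \<open>Scheduled insertions\<close>

text \<open>The edges in \<open>ev j\<close> are inserted in round \<open>j * r + 1\<close>.\<close>

definition scheduled :: "nat \<Rightarrow> nat \<Rightarrow> nat set set \<Rightarrow> (nat \<Rightarrow> nat set set) \<Rightarrow> nat \<Rightarrow> nat ugraph" where
  "scheduled n r E ev i = ({1..n}, E \<union> (\<Union>j\<in>{j. j * r < i}. ev j))"

lemma change_at_scheduled:
  assumes "change_at (scheduled n r E ev) i"
  shows "\<exists>j. i = Suc (j * r)"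
proof (rule ccontr)
  assume no: "\<nexists>j. i = Suc (j * r)"
  from assms have "1 \<le> i" by (simp add: change_at_def)
  then obtain i' where i': "i = Suc i'" by (cases i) auto
  have "j * r < Suc i' \<longleftrightarrow> j * r < i'" for j
    using no i' by (metis less_Suc_eq)
  then have "scheduled n r E ev i = scheduled n r E ev (i - 1)"
    unfolding i' scheduled_def by simp
  with assms show False by (simp add: change_at_def)
qed

text \<open>Distinct rounds of the form \<open>Suc (j * r)\<close> are at least \<open>r\<close>
  apart, one more than the offset \<open>r - 1\<close> that the promise excludes.\<close>

lemma promise_scheduled:
  assumes "1 \<le> r"
  shows "promise r (scheduled n r E ev)"
  unfolding promise_def
proof (intro allI impI notI)
  fix i i' assume c: "change_at (scheduled n r E ev) i" "change_at (scheduled n r E ev) i'"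
    and b: "i < i' \<and> i' \<le> i + r - 1"
  obtain j j' where j: "i = Suc (j * r)" "i' = Suc (j' * r)"
    using c change_at_scheduled by meson
  have "j * r < j' * r" using b j by simp
  then have "Suc j \<le> j'" by simp
  then have "Suc j * r \<le> j' * r" by (rule mult_le_mono1)
  then show False using b j assms by simp
qed

lemma insertion_sequence_scheduled:
  assumes r: "1 \<le> r"
    and E: "E \<subseteq> {{a, b} | a b. a \<in> {1..n} \<and> b \<in> {1..n} \<and> a \<noteq> b}"
    and ev: "\<And>j. ev j \<subseteq> {{a, b} | a b. a \<in> {1..n} \<and> b \<in> {1..n} \<and> a \<noteq> b}"
    and single: "\<And>j. \<exists>e. ev j \<subseteq> {e}"
  shows "insertion_sequence n (scheduled n r E ev)"
  unfolding insertion_sequence_def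
proof (intro conjI allI)
  fix i
  show "simple_graph (scheduled n r E ev i)"
    unfolding simple_graph_def scheduled_def using E ev by (simp add: UN_subset_iff)
  show "verts (scheduled n r E ev i) = {1..n}"
    by (simp add: scheduled_def)
  show "edges (scheduled n r E ev (Suc i)) = edges (scheduled n r E ev i) \<or>
      (\<exists>e. edges (scheduled n r E ev (Suc i)) = insert e (edges (scheduled n r E ev i)))"
  proof (cases "\<exists>j. i = j * r")
    case True
    then obtain j where j: "i = j * r" by blast
    \<comment> \<open>Since \<open>r\<close> is positive, \<open>j\<close> is the only index with
      \<open>j * r = i\<close>, so exactly one event becomes active in this round.\<close>
    have "{j'. j' * r < Suc i} = insert j {j'. j' * r < i}"
      using r unfolding j by (auto simp: less_Suc_eq)
    then have "edges (scheduled n r E ev (Suc i)) = ev j \<union> edges (scheduled n r E ev i)"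
      unfolding scheduled_def by auto
    moreover obtain e where "ev j \<subseteq> {e}" using single by blast
    ultimately show ?thesis by (metis insert_is_Un subset_singletonD sup_bot_left)
  next
    case False
    then have "{j'. j' * r < Suc i} = {j'. j' * r < i}"
      by (auto simp: less_Suc_eq)
    then show ?thesis unfolding scheduled_def by simp
  qed
qed

section \<open>Copies of a graph\<close>

definition map_graph :: "('a \<Rightarrow> 'b) \<Rightarrow> 'a ugraph \<Rightarrow> 'b ugraph" where
  "map_graph f H = (f ` verts H, (`) f ` edges H)"

lemma simple_graph_edgeE:
  assumes "simple_graph H" "e \<in> edges H"
  obtains a b where "e = {a, b}" "a \<in> verts H" "b \<in> verts H" "a \<noteq> b"
  using assms unfolding simple_graph_def by blast

lemma simple_graph_edgeD:
  assumes "simple_graph H" "{a, b} \<in> edges H"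
  shows "a \<in> verts H" "b \<in> verts H" "a \<noteq> b"
  using assms by (auto elim!: simple_graph_edgeE simp: doubleton_eq_iff)

lemma image_edge_iff:
  assumes "simple_graph H" "inj_on f (verts H)" "e \<subseteq> verts H"
  shows "f ` e \<in> (`) f ` edges H \<longleftrightarrow> e \<in> edges H"
proof
  assume "f ` e \<in> (`) f ` edges H"
  then obtain e' where e': "e' \<in> edges H" "f ` e = f ` e'" by blast
  have "e' \<subseteq> verts H" using assms(1) e'(1) by (auto elim: simple_graph_edgeE)
  then have "e = e'" using assms e' inj_on_image_eq_iff by metis
  then show "e \<in> edges H" using e' by simp
qed simp

lemma simple_graph_map_graph:
  assumes "simple_graph H" "inj_on f (verts H)"
  shows "simple_graph (map_graph f H)"
proof -
  have "\<exists>a b. f ` e = {a, b} \<and> a \<in> f ` verts H \<and> b \<in> f ` verts H \<and> a \<noteq> b" if "e \<in> edges H" for e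
  proof -
    obtain a b where "e = {a, b}" "a \<in> verts H" "b \<in> verts H" "a \<noteq> b"
      using assms(1) \<open>e \<in> edges H\<close> by (rule simple_graph_edgeE)
    then show ?thesis using inj_onD[OF assms(2)]
      by (intro exI[of _ "f a"] exI[of _ "f b"]) auto
  qed
  then show ?thesis using assms(1) unfolding simple_graph_def map_graph_def by auto
qed

lemma graph_iso_map_graph:
  assumes "simple_graph H" "inj_on f (verts H)"
  shows "graph_iso (map_graph f H) H"
  unfolding graph_iso_def
proof (intro exI conjI ballI)
  let ?g = "the_inv_into (verts H) f"
  show "bij_betw ?g (verts (map_graph f H)) (verts H)"
    using assms(2) by (simp add: map_graph_def bij_betw_the_inv_into inj_on_imp_bij_betw)
  fix a b assume "a \<in> verts (map_graph f H)" "b \<in> verts (map_graph f H)"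
  then obtain a' b' where ab: "a' \<in> verts H" "b' \<in> verts H" "a = f a'" "b = f b'"
    by (auto simp: map_graph_def)
  have "{a, b} \<in> edges (map_graph f H) \<longleftrightarrow> f ` {a', b'} \<in> (`) f ` edges H"
    using ab by (simp add: map_graph_def)
  also have "\<dots> \<longleftrightarrow> {a', b'} \<in> edges H"
    using assms ab by (intro image_edge_iff) auto
  finally show "{a, b} \<in> edges (map_graph f H) \<longleftrightarrow> {?g a, ?g b} \<in> edges H"
    using ab assms(2) by (simp add: the_inv_into_f_f)
qed

text \<open>An injective image of \<open>H\<close> is simple and isomorphic to \<open>H\<close> by
  construction, so listing it reduces to a question about edges of \<open>G\<close>.\<close>

lemma map_graph_in_mem_list_iff:
  assumes "simple_graph H" "inj_on f (verts H)" "f ` verts H \<subseteq> verts G" "x \<in> f ` verts H"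
  shows "map_graph f H \<in> mem_list H G x \<longleftrightarrow> (\<forall>e\<in>edges H. f ` e \<in> edges G)"
  using assms simple_graph_map_graph[OF assms(1,2)] graph_iso_map_graph[OF assms(1,2)]
  by (auto simp: mem_list_def subgraph_def map_graph_def)

section \<open>The hard family of insertion sequences\<close>

text \<open>\<open>f\<close> assigns the IDs \<open>1\<close> to \<open>k\<close> to the vertices of
  \<open>H\<close>, \<open>g\<close> enumerates the neighbors of \<open>u\<close>, so that
  \<open>d\<close> is the degree of \<open>u\<close>, and \<open>m\<close> is the number of
  candidates for \<open>v\<close>.\<close>

locale hard_family =
  fixes H :: "'h ugraph" and u v w :: 'h and f :: "'h \<Rightarrow> nat" and g :: "nat \<Rightarrow> 'h"
    and d m r :: nat
  assumes simple: "simple_graph H"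
    and u: "u \<in> verts H" and v: "v \<in> verts H" and uv: "u \<noteq> v" "{u, v} \<notin> edges H"
    and w: "{v, w} \<in> edges H"
    and f: "bij_betw f (verts H) {1..card (verts H)}"
    and g: "bij_betw g {..<d} (neighbors H u)"
    and d: "1 \<le> d"
    and r: "1 \<le> r"
begin

abbreviation k :: nat where "k \<equiv> card (verts H)"

text \<open>All copies share the nodes \<open>f a\<close> with \<open>a\<close> other than
  \<open>v\<close>; only the image of \<open>v\<close> depends on \<open>j\<close>. Candidates get
  IDs above \<open>k\<close>, and \<open>f v\<close> stays an isolated node, which makes the network
  size \<open>k + m\<close>.\<close>

definition emb :: "nat \<Rightarrow> 'h \<Rightarrow> nat" where
  "emb j = f(v := Suc k + j)"

definition base_edges :: "nat set set" where
  "base_edges = {emb j ` e | j e. j < m \<and> e \<in> edges H \<and> u \<notin> e \<and> e \<noteq> {v, w}}"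

text \<open>A candidate outside \<open>S\<close> leaves its slot empty instead of shifting later
  events. Hence the edges at \<open>f u\<close> appear in the same rounds for every
  \<open>S\<close>.\<close>

definition events :: "nat set \<Rightarrow> nat \<Rightarrow> nat set set" where
  "events S j = (if j < m then (if j \<in> S then {emb j ` {v, w}} else {})
     else if j < m + d then {{f u, f (g (j - m))}} else {})"

abbreviation G :: "nat set \<Rightarrow> nat \<Rightarrow> nat ugraph" where
  "G S \<equiv> scheduled (k + m) r base_edges (events S)"

abbreviation last_change :: nat where
  "last_change \<equiv> Suc ((m + d - 1) * r)"

section \<open>Placement of the copies of \<open>H\<close>\<close>

lemma f_range: "a \<in> verts H \<Longrightarrow> f a \<in> {1..k}"
  using f by (auto simp: bij_betw_def)

lemma f_inj: "inj_on f (verts H)"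
  using f by (rule bij_betw_imp_inj_on)

lemma w_in: "w \<in> verts H" "v \<noteq> w"
  using simple_graph_edgeD[OF simple w] by auto

text \<open>Non-adjacency of \<open>u\<close> and \<open>v\<close> enters here: joining candidates
  to \<open>w\<close> never touches the neighborhood of \<open>u\<close>.\<close>

lemma w_ne_u: "w \<noteq> u"
  using w uv by (auto simp: insert_commute)

lemma emb_inj: "inj_on (emb j) (verts H)"
proof (rule inj_onI)
  fix a b assume "a \<in> verts H" "b \<in> verts H" "emb j a = emb j b"
  then show "a = b"
    using f_range[of a] f_range[of b] inj_onD[OF f_inj, of a b]
    by (auto simp: emb_def split: if_splits)
qed

lemma emb_range: "j < m \<Longrightarrow> a \<in> verts H \<Longrightarrow> emb j a \<in> {1..k + m}"
  using f_range[of a] by (auto simp: emb_def)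

lemma emb_u: "emb j u = f u"
  using uv by (simp add: emb_def)

lemma emb_eq_f_u: "a \<in> verts H \<Longrightarrow> emb j a = f u \<longleftrightarrow> a = u"
  using inj_on_eq_iff[OF emb_inj, of a u j] u by (simp add: emb_u)

lemma nbr:
  assumes "l < d"
  shows "{u, g l} \<in> edges H" "g l \<in> verts H" "g l \<noteq> u" "g l \<noteq> v"
proof -
  show e: "{u, g l} \<in> edges H"
    using assms g by (auto simp: bij_betw_def neighbors_def insert_commute)
  show "g l \<in> verts H" "g l \<noteq> u" using simple_graph_edgeD[OF simple e] by auto
  show "g l \<noteq> v" using e uv by auto
qed

lemma f_g_eq_iff: "l < d \<Longrightarrow> l' < d \<Longrightarrow> f (g l) = f (g l') \<longleftrightarrow> l = l'"
  using inj_on_eq_iff[OF f_inj nbr(2) nbr(2)] inj_on_eq_iff[OF bij_betw_imp_inj_on[OF g]] by simp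

lemma emb_edge:
  assumes "j < m" "e \<in> edges H"
  shows "emb j ` e \<in> {{a, b} | a b. a \<in> {1..k + m} \<and> b \<in> {1..k + m} \<and> a \<noteq> b}"
proof -
  obtain a b where ab: "e = {a, b}" "a \<in> verts H" "b \<in> verts H" "a \<noteq> b"
    using simple assms(2) by (rule simple_graph_edgeE)
  then have "emb j a \<noteq> emb j b" using inj_onD[OF emb_inj] by blast
  moreover have "emb j ` e = {emb j a, emb j b}" using ab by simp
  ultimately show ?thesis using emb_range[OF assms(1)] ab by blast
qed

section \<open>The dynamic graphs and the view of the node \<open>f u\<close>\<close>

lemma insertion_sequence_G: "insertion_sequence (k + m) (G S)"
proof (rule insertion_sequence_scheduled[OF r])
  show "base_edges \<subseteq> {{a, b} | a b. a \<in> {1..k + m} \<and> b \<in> {1..k + m} \<and> a \<noteq> b}"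
    using emb_edge unfolding base_edges_def by blast
  fix j
  show "\<exists>e. events S j \<subseteq> {e}" by (auto simp: events_def)
  show "events S j \<subseteq> {{a, b} | a b. a \<in> {1..k + m} \<and> b \<in> {1..k + m} \<and> a \<noteq> b}"
  proof
    fix e assume e: "e \<in> events S j"
    show "e \<in> {{a, b} | a b. a \<in> {1..k + m} \<and> b \<in> {1..k + m} \<and> a \<noteq> b}"
    proof (cases "j < m")
      case True
      then have "e = emb j ` {v, w}" using e by (simp add: events_def split: if_splits)
      then show ?thesis using emb_edge[OF True w] by simp
    next
      case False
      then have l: "j - m < d" and e': "e = {f u, f (g (j - m))}"
        using e by (auto simp: events_def split: if_splits)
      have "f u \<in> {1..k + m}" "f (g (j - m)) \<in> {1..k + m}"
        using f_range[OF u] f_range[OF nbr(2)[OF l]] by auto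
      moreover have "f u \<noteq> f (g (j - m))"
        using inj_on_eq_iff[OF f_inj u nbr(2)[OF l]] nbr(3)[OF l] by simp
      ultimately show ?thesis using e' by blast
    qed
  qed
qed

text \<open>The right-hand side is free of \<open>S\<close>, so the neighbor lists of
  \<open>f u\<close> reveal nothing about it. Base edges avoid \<open>f u\<close> because edges at
  \<open>u\<close> are withheld, candidate edges because \<open>v\<close> and \<open>w\<close>
  differ from \<open>u\<close>.\<close>

lemma neighbors_G:
  "neighbors (G S i) (f u) = (\<lambda>l. f (g l)) ` {l. l < d \<and> (m + l) * r < i}"
proof -
  have base: "{a, f u} \<notin> base_edges" for a
  proof
    assume "{a, f u} \<in> base_edges"
    then obtain j e where je: "{a, f u} = emb j ` e" "e \<in> edges H" "u \<notin> e"
      by (auto simp: base_edges_def)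
    then obtain b where b: "b \<in> e" "emb j b = f u" by (metis image_iff insertI1 insert_commute)
    then have "b \<in> verts H" using simple je(2) by (auto elim: simple_graph_edgeE)
    then show False using b je(3) emb_eq_f_u by blast
  qed
  have cand: "{a, f u} \<noteq> emb j ` {v, w}" for a j
    using emb_eq_f_u[of v j] emb_eq_f_u[of w j] v w_in w_ne_u uv by (auto simp: doubleton_eq_iff)
  have pair: "{a, f u} = {f u, f b} \<longleftrightarrow> a = f b" for a b
    by (auto simp: doubleton_eq_iff)
  have ev: "{a, f u} \<in> events S j \<longleftrightarrow> (\<exists>l<d. j = m + l \<and> a = f (g l))" for a j
  proof (cases "j < m")
    case True
    then show ?thesis using cand by (simp add: events_def)
  next
    case False
    then have "(\<exists>l<d. j = m + l \<and> a = f (g l)) \<longleftrightarrow> j < m + d \<and> a = f (g (j - m))"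
      by (auto intro!: exI[of _ "j - m"])
    then show ?thesis using False pair by (simp add: events_def)
  qed
  show ?thesis
    unfolding neighbors_def scheduled_def by (auto simp: base ev image_iff)
qed

text \<open>The edge from \<open>f u\<close> to its last neighbor \<open>f (g (d - 1))\<close> is
  new in this round for every \<open>S\<close>, so all members of the family owe an answer at the
  same time.\<close>

lemma change_at_last: "change_at (G S) last_change"
proof -
  let ?l = "d - 1"
  have idx: "m + d - 1 = m + ?l" "?l < d" using d by auto
  have "f (g ?l) \<in> neighbors (G S last_change) (f u)"
    unfolding neighbors_G using idx by auto
  moreover have "f (g ?l) \<notin> neighbors (G S (last_change - 1)) (f u)"
    unfolding neighbors_G using idx r by (auto simp: f_g_eq_iff)
  ultimately have "G S last_change \<noteq> G S (last_change - 1)" by metis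
  then show ?thesis by (simp add: change_at_def)
qed

section \<open>Recovering \<open>S\<close> from the list required of \<open>f u\<close>\<close>

lemma candidate_edge_iff:
  assumes "j < m"
  shows "emb j ` {v, w} \<in> edges (G S last_change) \<longleftrightarrow> j \<in> S"
proof
  assume "j \<in> S"
  have "j * r < last_change" unfolding less_Suc_eq_le using assms d by (intro mult_le_mono1) linarith
  moreover have "emb j ` {v, w} \<in> events S j" using assms \<open>j \<in> S\<close> by (simp add: events_def)
  ultimately show "emb j ` {v, w} \<in> edges (G S last_change)"
    by (auto simp: scheduled_def)
next
  assume "emb j ` {v, w} \<in> edges (G S last_change)"
  then consider "emb j ` {v, w} \<in> base_edges" | i where "emb j ` {v, w} \<in> events S i"
    by (auto simp: scheduled_def)
  then show "j \<in> S"
  proof cases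
    case 1
    then obtain i e where ie: "emb j ` {v, w} = emb i ` e" "e \<in> edges H" "e \<noteq> {v, w}"
      by (auto simp: base_edges_def)
    have sub: "e \<subseteq> verts H" using simple ie(2) by (auto elim: simple_graph_edgeE)
    obtain b where b: "b \<in> e" "emb j v = emb i b" using ie(1) by (metis image_iff insertI1)
    \<comment> \<open>The ID \<open>Suc k + j\<close> exceeds every value of \<open>f\<close>, so it
      can only be the image of \<open>v\<close> in copy \<open>j\<close>. Then \<open>e\<close>
      would be \<open>{v, w}\<close>, which \<open>base_edges\<close> excludes.\<close>
    then have "i = j" using f_range[of b] sub by (auto simp: emb_def split: if_splits)
    then have "e = {v, w}"
      using inj_on_image_eq_iff[OF emb_inj, of e "{v, w}" j] sub ie(1) v w_in by simp
    then show ?thesis using ie by simp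
  next
    case 2
    show ?thesis
    proof (cases "i < m")
      case True
      then have "i \<in> S" "emb j ` {v, w} = emb i ` {v, w}"
        using 2 by (auto simp: events_def split: if_splits)
      \<comment> \<open>Either the candidates coincide, or the candidate is matched with
        \<open>f w\<close>, which is impossible because \<open>f w\<close> is at most
        \<open>k\<close>.\<close>
      then have "Suc k + j = Suc k + i \<or> Suc k + j = f w"
        using w_in by (auto simp: emb_def doubleton_eq_iff)
      then show ?thesis using f_range[OF w_in(1)] \<open>i \<in> S\<close> by auto
    next
      case False
      then have "i - m < d" "emb j ` {v, w} = {f u, f (g (i - m))}"
        using 2 by (auto simp: events_def split: if_splits)
      then have "emb j v \<in> {1..k}"
        using f_range[OF u] f_range[OF nbr(2)[of "i - m"]] by (auto simp: doubleton_eq_iff)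
      then show ?thesis by (simp add: emb_def)
    qed
  qed
qed

text \<open>In the final graph every edge of the copy except the image of \<open>{v, w}\<close> is
  present for all \<open>S\<close>: edges away from \<open>u\<close> from the start, edges at
  \<open>u\<close> through the last \<open>d\<close> events. Only the candidate edge
  decides.\<close>

lemma copy_in_mem_list_iff:
  assumes j: "j < m"
  shows "map_graph (emb j) H \<in> mem_list H (G S last_change) (f u) \<longleftrightarrow> j \<in> S"
proof -
  have other: "emb j ` e \<in> edges (G S last_change)" if e: "e \<in> edges H" "e \<noteq> {v, w}" for e
  proof (cases "u \<in> e")
    case False
    then have "emb j ` e \<in> base_edges" using e j by (auto simp: base_edges_def)
    then show ?thesis by (simp add: scheduled_def)
  next
    case True
    obtain z where z: "e = {u, z}"
      using True e(1) simple by (elim simple_graph_edgeE) (auto simp: insert_commute)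
    then have "z \<in> neighbors H u" using e(1) by (simp add: neighbors_def insert_commute)
    then obtain l where l: "l < d" "z = g l" using g by (auto simp: bij_betw_def)
    have "emb j ` e = {f u, f (g l)}" using z l nbr(4)[OF l(1)] by (simp add: emb_u) (simp add: emb_def)
    then have "emb j ` e \<in> events S (m + l)" using l by (simp add: events_def)
    moreover have "(m + l) * r < last_change" unfolding less_Suc_eq_le using l by (intro mult_le_mono1) linarith
    ultimately show ?thesis by (auto simp: scheduled_def)
  qed
  have "map_graph (emb j) H \<in> mem_list H (G S last_change) (f u) \<longleftrightarrow>
      (\<forall>e\<in>edges H. emb j ` e \<in> edges (G S last_change))"
  proof (rule map_graph_in_mem_list_iff[OF simple emb_inj])
    show "emb j ` verts H \<subseteq> verts (G S last_change)"
      using emb_range[OF j] by (auto simp: scheduled_def)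
    show "f u \<in> emb j ` verts H" using emb_u u by (metis imageI)
  qed
  also have "\<dots> \<longleftrightarrow> j \<in> S" using other w candidate_edge_iff[OF j] by metis
  finally show ?thesis .
qed

text \<open>The \<open>2 ^ m\<close> subsets require different lists at \<open>f u\<close>, which
  receives at most \<open>d\<close> messages of \<open>B\<close> bits in each of
  \<open>d * r\<close> rounds and none earlier.\<close>

lemma bandwidth_bound:
  assumes "has_bandwidth A B" "solves A (k + m) r (mem_list H)"
  shows "m \<le> B * (d * (d * r))"
proof -
  let ?N = "\<lambda>i. (\<lambda>l. f (g l)) ` {l. l < d \<and> (m + l) * r < i}"
  \<comment> \<open>This is the round in which the answer to the last change is due.\<close>
  have R: "last_change + r - 1 = (m + d) * r"
    using d by (cases d) auto
  have "card (Pow {..<m}) \<le> 2 ^ (B * (\<Sum>i=1..last_change + r - 1. card (?N i)))"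
  proof (rule indistinguishable_family_bound[where G = G and i = last_change and
        v = "f u" and P = "mem_list H" and r = r and n = "k + m"])
    show "insertion_sequence (k + m) (G S) \<and> promise r (G S)" for S
      using insertion_sequence_G promise_scheduled[OF r] by blast
    show "G S 0 = ({1..k + m}, base_edges)" for S
      by (simp add: scheduled_def)
    show "f u \<in> {1..k + m}" using f_range[OF u] by simp
    show "inj_on (\<lambda>S. mem_list H (G S last_change) (f u)) (Pow {..<m})"
    proof (rule inj_onI)
      fix S T assume ST: "S \<in> Pow {..<m}" "T \<in> Pow {..<m}"
        and eq: "mem_list H (G S last_change) (f u) = mem_list H (G T last_change) (f u)"
      have "j \<in> S \<longleftrightarrow> j \<in> T" if "j < m" for j
        using copy_in_mem_list_iff[OF that, of S] copy_in_mem_list_iff[OF that, of T] eq by simp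
      then show "S = T" using ST by blast
    qed
  qed (use assms change_at_last neighbors_G in auto)
  then have "2 ^ m \<le> (2::nat) ^ (B * (\<Sum>i=1..(m + d) * r. card (?N i)))"
    unfolding R by (simp add: card_Pow)
  then have "m \<le> B * (\<Sum>i=1..(m + d) * r. card (?N i))" by simp
  \<comment> \<open>Up to round \<open>m * r\<close>, while \<open>S\<close> is being inserted,
    \<open>f u\<close> is isolated and hears nothing.\<close>
  also have "(\<Sum>i=1..(m + d) * r. card (?N i)) = (\<Sum>i\<in>{m * r<..(m + d) * r}. card (?N i))"
  proof (rule sum.mono_neutral_right)
    show "\<forall>i\<in>{1..(m + d) * r} - {m * r<..(m + d) * r}. card (?N i) = 0"
    proof
      fix i assume "i \<in> {1..(m + d) * r} - {m * r<..(m + d) * r}"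
      then have "\<not> (m + l) * r < i" for l by (auto simp: add_mult_distrib)
      then show "card (?N i) = 0" by simp
    qed
  qed auto
  also have "\<dots> \<le> (\<Sum>i\<in>{m * r<..(m + d) * r}. d)"
  proof (rule sum_mono)
    fix i
    have "card (?N i) \<le> card {l. l < d \<and> (m + l) * r < i}" by (rule card_image_le) simp
    also have "\<dots> \<le> card {..<d}" by (rule card_mono) auto
    finally show "card (?N i) \<le> d" by simp
  qed
  also have "\<dots> = d * (d * r)" by (simp add: add_mult_distrib)
  finally show ?thesis by simp
qed

end

section \<open>The lower bound\<close>

lemma connected_graph_neighbor:
  assumes "connected_graph H" "a \<in> verts H" "b \<in> verts H" "a \<noteq> b"
  obtains c where "{a, c} \<in> edges H"
proof -
  have "(a, b) \<in> {(x, y). {x, y} \<in> edges H}\<^sup>*"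
    using assms unfolding connected_graph_def by blast
  then show ?thesis
    by (rule converse_rtranclE) (use assms(4) that in auto)
qed

text \<open>All nodes beyond the first \<open>card (verts H)\<close> serve as candidates, and the
  degree of \<open>u\<close> is at most \<open>card (verts H)\<close>. For small \<open>n\<close>
  the truncated subtraction makes the left side zero.\<close>

lemma mem_list_bandwidth_bound:
  assumes "simple_graph H" "connected_graph H" "\<not> is_clique H" "1 \<le> r"
    and "has_bandwidth A B" "solves A n r (mem_list H)"
  shows "n - card (verts H) \<le> B * (card (verts H))\<^sup>2 * r"
proof (cases "n \<le> card (verts H)")
  case False
  let ?k = "card (verts H)"
  have fin: "finite (verts H)" using assms(1) by (simp add: simple_graph_def)
  obtain u v where uv: "u \<in> verts H" "v \<in> verts H" "u \<noteq> v" "{u, v} \<notin> edges H"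
    using assms(3) by (auto simp: is_clique_def)
  obtain w where w: "{v, w} \<in> edges H"
    \<comment> \<open>Connectedness gives both \<open>u\<close> and \<open>v\<close> a neighbor,
      since each has a path to the other.\<close>
    using connected_graph_neighbor[OF assms(2) uv(2) uv(1)] uv(3) by metis
  obtain z where z: "{u, z} \<in> edges H"
    using connected_graph_neighbor[OF assms(2) uv(1) uv(2)] uv(3) by metis
  have sub: "neighbors H u \<subseteq> verts H"
    using simple_graph_edgeD[OF assms(1)] by (auto simp: neighbors_def)
  define d where "d = card (neighbors H u)"
  have finN: "finite (neighbors H u)" using sub fin finite_subset by blast
  have "z \<in> neighbors H u" using z by (simp add: neighbors_def insert_commute)
  then have d: "1 \<le> d" unfolding d_def using finN by (metis One_nat_def Suc_leI card_gt_0_iff empty_iff)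
  have dk: "d \<le> ?k" unfolding d_def using sub fin by (simp add: card_mono)
  obtain g where g: "bij_betw g {..<d} (neighbors H u)"
    using ex_bij_betw_nat_finite[OF finN] unfolding d_def by (auto simp: atLeast0LessThan)
  obtain f where f: "bij_betw f (verts H) {1..?k}"
    using finite_same_card_bij[OF fin, of "{1..?k}"] by auto
  interpret hard_family H u v w f g d "n - ?k" r
    using assms uv w f g d by unfold_locales auto
  have "n - ?k \<le> B * (d * (d * r))"
    using bandwidth_bound assms(5,6) False by simp
  also have "\<dots> \<le> B * (?k * (?k * r))"
    using dk by (intro mult_le_mono) auto
  finally show ?thesis by (simp add: power2_eq_square algebra_simps)
qed simp

lemma bandwidth_complexity_cases:
  obtains "bandwidth_complexity n r P = \<infinity>"
  | A B where "bandwidth_complexity n r P = enat B" "has_bandwidth A B" "solves A n r P"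
proof (cases "{B. \<exists>A. has_bandwidth A B \<and> solves A n r P} = {}")
  case True
  then have "bandwidth_complexity n r P = \<infinity>"
    unfolding bandwidth_complexity_def True by (simp add: top_enat_def)
  then show ?thesis by (rule that(1))
next
  case False
  let ?X = "enat ` {B. \<exists>A. has_bandwidth A B \<and> solves A n r P}"
  have "Inf ?X \<in> ?X"
    \<comment> \<open>The infimum of a nonempty set of extended naturals is its least element, so an
      optimal algorithm exists.\<close>
    using False unfolding Inf_enat_def by (simp del: image_iff) (metis (mono_tags, lifting) LeastI image_eqI mem_Collect_eq)
  then show ?thesis using that(2) unfolding bandwidth_complexity_def by blast
qed

theorem theorem5p6:
  fixes H :: "'h ugraph"
  assumes "simple_graph H"
    and "connected_graph H"
    and "card (verts H) \<ge> 3"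
    and "\<not> is_clique H"
  shows "\<exists>c::real. c > 0 \<and> (\<exists>N::nat. \<forall>n\<ge>N. \<forall>r::nat. r \<ge> 1 \<longrightarrow>
    ereal_of_enat (bandwidth_complexity n r (mem_list H)) \<ge> ereal (c * (real n / real r)))"
proof -
  let ?k = "card (verts H)"
  \<comment> \<open>The square comes from the two factors \<open>d\<close>, each at most
    \<open>?k\<close>; the \<open>2\<close> comes from \<open>n - ?k\<close> being at least half of
    \<open>n\<close> once \<open>2 * ?k \<le> n\<close>.\<close>
  let ?c = "1 / (2 * (real ?k)\<^sup>2)"
  have k: "real ?k > 0" using assms(3) by simp
  have "ereal (?c * (real n / real r)) \<le> ereal_of_enat (bandwidth_complexity n r (mem_list H))"
    if n: "2 * ?k \<le> n" and r: "1 \<le> r" for n r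
  proof (cases n r "mem_list H" rule: bandwidth_complexity_cases)
    case 1
    then show ?thesis by simp
  next
    case (2 A B)
    have "n - ?k \<le> B * ?k\<^sup>2 * r"
      using mem_list_bandwidth_bound[OF assms(1,2,4) r 2(2,3)] .
    then have "n \<le> 2 * (B * ?k\<^sup>2 * r)" using n by linarith
    then have "real n \<le> real (2 * (B * ?k\<^sup>2 * r))" by (rule of_nat_mono)
    then have "?c * (real n / real r) \<le> real B"
      using k r by (simp add: field_simps)
    then show ?thesis using 2(1) by simp
  qed
  moreover have "?c > 0" using k by simp
  ultimately show ?thesis by blast
qed

end
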